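(* For every real $\varepsilon > 0$ and every integer $k\geq 2$, there exist positive integers $C = C(\varepsilon, k)$ and $n_0 = n_0(\varepsilon, k)$ such that the following holds for all $n \geq n_0$. If $H$ is an $n$-vertex linear $k$-graph with $\delta(H) \geq \frac{n}{k} + C$, then $H$ contains a matching $M$ that covers at least $(1 - \varepsilon)n$ vertices.
   Context: A $k$-graph is a (simple, finite) hypergraph in which every edge has exactly $k$ vertices. A hypergraph is linear if every two distinct edges share at most one vertex. The degree of a vertex is the number of edges containing it, and $\delta(H)$ denotes the minimum degree of $H$. A matching is a set of pairwise vertex-disjoint edges; it covers the vertices contained in its edges. *)

theory Defs
  imports Complex_Main
begin

text \<open>Since \<open>E\<close> is a set of sets, there are no repeated edges.\<close>

locale hypergraph =
  fixes V :: "'a set" and E :: "'a set set"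
  assumes finite_vertices: "finite V"
    and edges_subset: "e \<in> E \<Longrightarrow> e \<subseteq> V"

locale k_graph = hypergraph V E
  for V :: "'a set" and E :: "'a set set" and k :: nat +
  assumes edge_card: "e \<in> E \<Longrightarrow> card e = k"

locale linear_hypergraph = hypergraph V E
  for V :: "'a set" and E :: "'a set set" +
  assumes edges_share_at_most_one:
    "e \<in> E \<Longrightarrow> f \<in> E \<Longrightarrow> e \<noteq> f \<Longrightarrow> card (e \<inter> f) \<le> 1"

definition degree :: "'a set set \<Rightarrow> 'a \<Rightarrow> nat" where
  "degree E v = card {e \<in> E. v \<in> e}"

text \<open>Only meaningful when \<open>V\<close> is finite and nonempty.\<close>

definition min_degree :: "'a set \<Rightarrow> 'a set set \<Rightarrow> nat" where
  "min_degree V E = Min (degree E ` V)"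

definition matching :: "'a set set \<Rightarrow> 'a set set \<Rightarrow> bool" where
  "matching E M \<longleftrightarrow> M \<subseteq> E \<and> pairwise disjnt M"

definition covered_vertices :: "'a set set \<Rightarrow> 'a set" where
  "covered_vertices M = \<Union>M"

end

theory Submission
  imports Defs
begin

text \<open>
  Let \<open>D\<close> be a small constant multiple of \<open>n\<close>, and let \<open>F \<subseteq> E\<close> minimise
  \<open>\<Sum>v. (deg F v - D)\<^sup>2\<close>. Put \<open>R v = D - deg F v\<close>. Comparing \<open>F\<close> with
  \<open>F - {e}\<close> and \<open>F \<union> {e}\<close> shows that \<open>\<Sum>v\<in>e. R v\<close> is at least \<open>-k/2\<close> for
  \<open>e \<in> F\<close> and at most \<open>k/2\<close> otherwise. Hence \<open>F\<close> has maximum degree \<open>O(D)\<close>, and summing over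
  the edges of \<open>E\<close> through a vertex that maximises \<open>R\<close>, of which there are at least \<open>n/k\<close>, bounds
  \<open>\<Sum>v. R v\<close> and therefore the minimum itself by \<open>k D\<^sup>3 + O(n D)\<close>, a small multiple of
  \<open>n D\<^sup>2\<close>: the subgraph \<open>F\<close> is nearly regular in the square mean.

  Then edges of \<open>F\<close> are selected greedily one at a time, deleting all edges that meet the selected
  one. With \<open>m\<close> vertices left, the target degree \<open>t\<close> is multiplied by \<open>1 - k(k-1)/m\<close> in each
  step. Averaging over all candidate edges shows that some choice increases the square deviation
  from \<open>t\<close> by a factor of at most \<open>1 + O(1/n)\<close> plus an additive \<open>O(D)\<close>, so that after at most
  \<open>n/k\<close> steps it is still small against \<open>n D\<^sup>2\<close>. As long as more than \<open>\<epsilon> n\<close> vertices remain,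
  \<open>t\<close> is of order \<open>D\<close>, so there are edges left and the selection does not stop.
\<close>

section \<open>Double counting and stars in linear k-graphs\<close>

locale linear_k_graph = k_graph V E k + linear_hypergraph V E
  for V :: "'a set" and E :: "'a set set" and k :: nat
begin

lemma finite_edges: "finite E"
  using finite_vertices edges_subset by (auto intro: finite_subset[of E "Pow V"])

lemma finite_edge: "e \<in> E \<Longrightarrow> finite e"
  using finite_vertices edges_subset finite_subset by blast

text \<open>Lets the facts of this locale be reused, by interpretation, for the square-minimising
  subgraph and for what remains after a partial matching is deleted.\<close>

lemma subgraph:
  assumes "F \<subseteq> E" "W \<subseteq> V" "\<And>e. e \<in> F \<Longrightarrow> e \<subseteq> W"
  shows "linear_k_graph W F k"
proof
  show "finite W"
    using assms(2) finite_vertices finite_subset by blast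
  show "e \<subseteq> W" if "e \<in> F" for e
    using assms(3) that .
  show "card e = k" if "e \<in> F" for e
    using assms(1) that edge_card by blast
  show "card (e \<inter> f) \<le> 1" if "e \<in> F" "f \<in> F" "e \<noteq> f" for e f
    using assms(1) that edges_share_at_most_one by blast
qed

lemma edge_unique:
  assumes "e \<in> E" "f \<in> E" "x \<in> e" "y \<in> e" "x \<in> f" "y \<in> f" "x \<noteq> y"
  shows "e = f"
proof (rule ccontr)
  assume "e \<noteq> f"
  then have "card (e \<inter> f) \<le> 1"
    using assms edges_share_at_most_one by blast
  moreover have "card {x, y} \<le> card (e \<inter> f)"
    using assms finite_edge by (intro card_mono) auto
  ultimately show False
    using \<open>x \<noteq> y\<close> by simp
qed

lemma sum_incidences:
  "(\<Sum>v\<in>V. \<Sum>e | e \<in> E \<and> v \<in> e. h v e) = (\<Sum>e\<in>E. \<Sum>v\<in>e. h v e :: real)"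
proof -
  have "(\<Sum>v\<in>V. \<Sum>e | e \<in> E \<and> v \<in> e. h v e) = (\<Sum>e\<in>E. \<Sum>v | v \<in> V \<and> v \<in> e. h v e)"
    by (rule sum.swap_restrict[OF finite_vertices finite_edges])
  also have "\<dots> = (\<Sum>e\<in>E. \<Sum>v\<in>e. h v e)"
    using edges_subset by (intro sum.cong) auto
  finally show ?thesis .
qed

lemma sum_degree_weighted: "(\<Sum>v\<in>V. g v * real (degree E v)) = (\<Sum>e\<in>E. \<Sum>v\<in>e. g v)"
  using sum_incidences[of "\<lambda>v e. g v"] by (simp add: degree_def mult.commute)

lemma sum_degree: "(\<Sum>v\<in>V. real (degree E v)) = real k * real (card E)"
  using sum_degree_weighted[of "\<lambda>v. 1"] edge_card by (simp add: mult.commute)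

text \<open>By linearity, the edges through \<open>v\<close> are disjoint outside \<open>v\<close>.\<close>

lemma star_sum_le:
  fixes g :: "'a \<Rightarrow> real"
  assumes "g v = 0" "\<And>x. x \<in> V \<Longrightarrow> 0 \<le> g x"
  shows "(\<Sum>e | e \<in> E \<and> v \<in> e. \<Sum>x\<in>e. g x) \<le> (\<Sum>x\<in>V. g x)"
proof -
  let ?S = "{e \<in> E. v \<in> e}"
  have "(\<Sum>e\<in>?S. \<Sum>x\<in>e. g x) = (\<Sum>e\<in>?S. \<Sum>x\<in>e - {v}. g x)"
    using assms(1) finite_edge by (intro sum.cong refl sum.mono_neutral_right) auto
  also have "\<dots> = (\<Sum>x\<in>(\<Union>e\<in>?S. e - {v}). g x)"
  proof (rule sum.UNION_disjoint[symmetric])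
    show "\<forall>e\<in>?S. \<forall>f\<in>?S. e \<noteq> f \<longrightarrow> (e - {v}) \<inter> (f - {v}) = {}"
      using edge_unique by blast
  qed (use finite_edges finite_edge in auto)
  also have "\<dots> \<le> (\<Sum>x\<in>V. g x)"
    using edges_subset assms(2) by (intro sum_mono2 finite_vertices) auto
  finally show ?thesis .
qed

text \<open>Every edge through \<open>v\<close> contains another vertex, and by linearity these
  vertices are distinct for distinct edges.\<close>

lemma degree_le:
  assumes "v \<in> V" "k \<ge> 2"
  shows "degree E v \<le> card V"
proof -
  let ?g = "\<lambda>x. if x = v then 0 else 1 :: real"
  have "real (degree E v) * 1 \<le> (\<Sum>e | e \<in> E \<and> v \<in> e. \<Sum>x\<in>e. ?g x)"
    unfolding degree_def
  proof (rule sum_bounded_below)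
    fix e assume e: "e \<in> {e \<in> E. v \<in> e}"
    then have "(\<Sum>x\<in>e. ?g x) = (\<Sum>x\<in>e - {v}. 1)"
      using finite_edge by (intro sum.mono_neutral_cong_right) auto
    also have "\<dots> = real (k - 1)"
      using e edge_card finite_edge by (simp add: card_Diff_singleton)
    finally show "1 \<le> (\<Sum>x\<in>e. ?g x)"
      using assms(2) by simp
  qed
  also have "\<dots> \<le> (\<Sum>x\<in>V. ?g x)"
    by (rule star_sum_le) auto
  also have "\<dots> \<le> (\<Sum>x\<in>V. 1)"
    by (intro sum_mono) auto
  finally show ?thesis
    by simp
qed

end

section \<open>Square deviation of the degrees and a nearly regular subgraph\<close>

text \<open>The target \<open>t\<close> is a free real parameter rather than the average degree, so
  that its decrease can be prescribed during the greedy selection.\<close>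

definition degree_dev :: "'a set \<Rightarrow> 'a set set \<Rightarrow> real \<Rightarrow> real" where
  "degree_dev V E t = (\<Sum>v\<in>V. (real (degree E v) - t)\<^sup>2)"

context linear_k_graph
begin

lemma degree_insert:
  assumes "F \<subseteq> E" "e \<in> E" "e \<notin> F"
  shows "degree (insert e F) v = degree F v + (if v \<in> e then 1 else 0)"
proof -
  have "{f \<in> insert e F. v \<in> f} = (if v \<in> e then insert e {f \<in> F. v \<in> f} else {f \<in> F. v \<in> f})"
    by auto
  moreover have "finite F"
    using assms(1) finite_edges finite_subset by blast
  ultimately show ?thesis
    using assms(3) by (simp add: degree_def)
qed

text \<open>With R = D - degree, each of the k vertices of \<open>e\<close> changes its square by
  \<open>(R - 1)\<^sup>2 - R\<^sup>2 = 1 - 2 * R\<close>. Read backwards, this also covers deleting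
  an edge from the minimiser.\<close>

lemma degree_dev_insert:
  assumes "F \<subseteq> E" "e \<in> E" "e \<notin> F"
  shows "degree_dev V (insert e F) D = degree_dev V F D - 2 * (\<Sum>v\<in>e. D - real (degree F v)) + real k"
proof -
  have "degree_dev V (insert e F) D - degree_dev V F D
      = (\<Sum>v\<in>V. if v \<in> e then 1 - 2 * (D - real (degree F v)) else 0)"
    unfolding degree_dev_def sum_subtractf[symmetric]
    by (intro sum.cong) (auto simp: degree_insert[OF assms] power2_eq_square algebra_simps)
  also have "\<dots> = (\<Sum>v\<in>e. 1 - 2 * (D - real (degree F v)))"
    using edges_subset[OF assms(2)] finite_vertices
    by (simp add: sum.If_cases Int_absorb1)
  also have "\<dots> = real k - 2 * (\<Sum>v\<in>e. D - real (degree F v))"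
    using edge_card[OF assms(2)] by (simp add: sum_subtractf sum_distrib_left)
  finally show ?thesis
    by simp
qed

text \<open>This is where the lower bound n/k on the degrees enters. When D is a small multiple of
  n, the cubic term is a small multiple of n * D^2, and the other term is of lower order in
  D.\<close>

lemma nearly_regular_subgraph:
  assumes k: "k \<ge> 2" and "V \<noteq> {}" and D: "D \<ge> real k / 2"
    and deg: "\<And>v. v \<in> V \<Longrightarrow> real (card V) / real k \<le> real (degree E v)"
  obtains F where "F \<subseteq> E" "\<And>v. v \<in> V \<Longrightarrow> real (degree F v) \<le> (real k + 1) * D"
    "degree_dev V F D \<le> real k * D ^ 3 + (real k + 1) / 2 * real (card V) * D"
proof -
  have "finite (Pow E)" "Pow E \<noteq> {}"
    using finite_edges by auto
  then obtain F where "is_arg_min (\<lambda>F. degree_dev V F D) (\<lambda>F. F \<in> Pow E) F"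
    using ex_is_arg_min_if_finite by blast
  then have FE: "F \<subseteq> E" and min: "\<And>G. G \<subseteq> E \<Longrightarrow> degree_dev V F D \<le> degree_dev V G D"
    by (auto simp: is_arg_min_linorder)
  define R where "R = (\<lambda>v. D - real (degree F v))"
  define n where "n = real (card V)"
  interpret F: linear_k_graph V F k
    using subgraph[OF FE] FE edges_subset by blast
  have R_le: "R v \<le> D" for v
    by (simp add: R_def)
  have D1: "D \<ge> 1"
    using D k by linarith
  have R_out: "(\<Sum>v\<in>e. R v) \<le> real k / 2" if "e \<in> E" "e \<notin> F" for e
    using min[of "insert e F"] degree_dev_insert[OF FE that, of D] FE that by (simp add: R_def)
  \<comment> \<open>Passing to \<open>F - {e}\<close> raises \<open>R\<close> by 1 on each vertex of
    \<open>e\<close>, so minimality bounds the raised sum below by k/2.\<close>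
  have R_in: "(\<Sum>v\<in>e. R v) \<ge> - real k / 2" if e: "e \<in> F" for e
  proof -
    have "degree_dev V F D = degree_dev V (F - {e}) D
        - 2 * (\<Sum>v\<in>e. D - real (degree (F - {e}) v)) + real k"
      using degree_dev_insert[of "F - {e}" e D] FE e by (auto simp: insert_absorb)
    moreover have "degree_dev V F D \<le> degree_dev V (F - {e}) D"
      using min[of "F - {e}"] FE by blast
    moreover have "(\<Sum>v\<in>e. D - real (degree (F - {e}) v)) = (\<Sum>v\<in>e. R v + 1)"
    proof (rule sum.cong)
      fix v assume "v \<in> e"
      then have "degree F v = degree (F - {e}) v + 1"
        using degree_insert[of "F - {e}" e v] FE e by (auto simp: insert_absorb)
      then show "D - real (degree (F - {e}) v) = R v + 1"
        by (simp add: R_def)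
    qed simp
    moreover have "\<dots> = (\<Sum>v\<in>e. R v) + real k"
      using F.edge_card[OF e] by (simp add: sum.distrib)
    ultimately show ?thesis
      by simp
  qed
  \<comment> \<open>On an edge of \<open>F\<close> through \<open>v\<close> the other k - 1 vertices
    have \<open>R\<close> at most \<open>D\<close>, so \<open>R_in\<close> keeps \<open>R v\<close>
    from being very negative; D \<ge> k/2 absorbs the error.\<close>
  have deg_F: "real (degree F v) \<le> (real k + 1) * D" if "v \<in> V" for v
  proof (cases "{e \<in> F. v \<in> e} = {}")
    case True
    then show ?thesis
      using D1 by (simp only: degree_def) simp
  next
    case False
    then obtain e where e: "e \<in> F" "v \<in> e"
      by blast
    have "- real k / 2 \<le> R v + (\<Sum>x\<in>e - {v}. R x)"
      using R_in[OF e(1)] sum.remove[OF F.finite_edge[OF e(1)] e(2), of R] by simp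
    also have "(\<Sum>x\<in>e - {v}. R x) \<le> real (card (e - {v})) * D"
      using R_le by (intro sum_bounded_above)
    also have "card (e - {v}) = k - 1"
      using e F.edge_card F.finite_edge by (simp add: card_Diff_singleton)
    finally show ?thesis
      using k D by (simp add: R_def of_nat_diff algebra_simps)
  qed
  \<comment> \<open>For \<open>v\<close> maximising \<open>R\<close>, with value \<open>a\<close>,
    the function a - R is nonnegative and vanishes at \<open>v\<close>, so
    \<open>star_sum_le\<close> applies to it.\<close>
  have R_sum: "(\<Sum>v\<in>V. R v) \<le> real k * D\<^sup>2 + real k / 2 * n"
  proof -
    define a where "a = Max (R ` V)"
    have "a \<in> R ` V"
      unfolding a_def using finite_vertices \<open>V \<noteq> {}\<close> by (intro Max_in) auto
    then obtain v where v: "v \<in> V" "R v = a"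
      by blast
    have a: "R x \<le> a" if "x \<in> V" for x
      unfolding a_def using that finite_vertices by simp
    show ?thesis
    proof (cases "a \<ge> 0")
      case False
      then have "(\<Sum>v\<in>V. R v) \<le> 0"
        using a by (intro sum_nonpos) force
      then show ?thesis
        using n_def by (smt (verit) divide_nonneg_nonneg mult_nonneg_nonneg of_nat_0_le_iff zero_le_power2)
    next
      case True
      let ?S = "{e \<in> E. v \<in> e}"
      have fin: "finite ?S"
        using finite_edges by simp
      have "(\<Sum>e\<in>?S. \<Sum>x\<in>e. a - R x) \<le> (\<Sum>x\<in>V. a - R x)"
        using v a by (intro star_sum_le) auto
      moreover have "(\<Sum>e\<in>?S. \<Sum>x\<in>e. a - R x) = (\<Sum>e\<in>?S. real k * a - (\<Sum>x\<in>e. R x))"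
        using edge_card by (intro sum.cong) (auto simp: sum_subtractf)
      moreover have "\<dots> = real (degree E v) * (real k * a) - (\<Sum>e\<in>?S. \<Sum>x\<in>e. R x)"
        by (simp add: sum_subtractf degree_def)
      moreover have "(\<Sum>x\<in>V. a - R x) = n * a - (\<Sum>x\<in>V. R x)"
        by (simp add: sum_subtractf n_def)
      ultimately have *: "(\<Sum>x\<in>V. R x) \<le> n * a - real (degree E v) * (real k * a) + (\<Sum>e\<in>?S. \<Sum>x\<in>e. R x)"
        by linarith
      \<comment> \<open>The star has at least n/k edges with k vertices each, so the terms in
        \<open>a\<close> cancel in favour of the bound: the sum of \<open>R\<close> over V is at
        most its sum over the star.\<close>
      have "n \<le> real (degree E v) * real k"
        using deg[OF v(1)] k by (simp add: n_def field_simps)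
      then have **: "n * a \<le> real (degree E v) * (real k * a)"
        using True by (metis mult.assoc mult_right_mono)
      have Sp: "?S = {e \<in> F. v \<in> e} \<union> {e \<in> E - F. v \<in> e}"
        using FE by auto
      have "(\<Sum>e\<in>?S. \<Sum>x\<in>e. R x) = (\<Sum>e | e \<in> F \<and> v \<in> e. \<Sum>x\<in>e. R x) + (\<Sum>e | e \<in> E - F \<and> v \<in> e. \<Sum>x\<in>e. R x)"
        unfolding Sp using finite_edges F.finite_edges by (intro sum.union_disjoint) auto
      also have "(\<Sum>e | e \<in> F \<and> v \<in> e. \<Sum>x\<in>e. R x) \<le> real (card {e \<in> F. v \<in> e}) * (real k * D)"
      proof (rule sum_bounded_above)
        fix e assume "e \<in> {e \<in> F. v \<in> e}"
        then show "(\<Sum>x\<in>e. R x) \<le> real k * D"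
          using sum_bounded_above[of e R D] R_le F.edge_card by auto
      qed
      also have "card {e \<in> F. v \<in> e} = degree F v"
        by (simp add: degree_def)
      \<comment> \<open>R v = a \<ge> 0 says that at most \<open>D\<close> edges of the star lie in
        \<open>F\<close>. The remaining edges, at most \<open>n\<close> of them, contribute at most
        k/2 each by \<open>R_out\<close>.\<close>
      also have "real (degree F v) * (real k * D) \<le> D * (real k * D)"
        using v True D1 by (intro mult_right_mono) (auto simp: R_def)
      also have "(\<Sum>e | e \<in> E - F \<and> v \<in> e. \<Sum>x\<in>e. R x) \<le> real (card {e \<in> E - F. v \<in> e}) * (real k / 2)"
        using R_out by (intro sum_bounded_above) auto
      also have "\<dots> \<le> n * (real k / 2)"
      proof -
        have "card {e \<in> E - F. v \<in> e} \<le> degree E v"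
          unfolding degree_def using fin by (intro card_mono) auto
        then show ?thesis
          using degree_le[OF v(1) k] unfolding n_def by (intro mult_right_mono) auto
      qed
      finally show ?thesis
        using * ** by (simp add: power2_eq_square algebra_simps)
    qed
  qed
  \<comment> \<open>One factor of the square is split as D - degree: the first part yields the sum
    of \<open>R\<close> over V, and double counting turns the second into edge sums, bounded by
    \<open>R_in\<close>.\<close>
  have "degree_dev V F D = (\<Sum>v\<in>V. D * R v - R v * real (degree F v))"
    unfolding degree_dev_def by (intro sum.cong) (auto simp: R_def power2_eq_square algebra_simps)
  also have "\<dots> = D * (\<Sum>v\<in>V. R v) - (\<Sum>e\<in>F. \<Sum>v\<in>e. R v)"
    by (simp add: sum_subtractf sum_distrib_left F.sum_degree_weighted)
  also have "\<dots> \<le> D * (\<Sum>v\<in>V. R v) + real (card F) * (real k / 2)"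
    using sum_bounded_below[of F "- real k / 2" "\<lambda>e. \<Sum>v\<in>e. R v"] R_in by simp
  also have "real (card F) * (real k / 2) = (n * D - (\<Sum>v\<in>V. R v)) / 2"
    using F.sum_degree by (simp add: R_def n_def sum_subtractf)
  also have "D * (\<Sum>v\<in>V. R v) + (n * D - (\<Sum>v\<in>V. R v)) / 2
      = (D - 1 / 2) * (\<Sum>v\<in>V. R v) + n * D / 2"
    by (simp add: algebra_simps diff_divide_distrib)
  also have "(D - 1 / 2) * (\<Sum>v\<in>V. R v) \<le> (D - 1 / 2) * (real k * D\<^sup>2 + real k / 2 * n)"
    using R_sum D1 by (intro mult_left_mono) auto
  also have "\<dots> \<le> D * (real k * D\<^sup>2 + real k / 2 * n)"
    by (intro mult_right_mono) (auto simp: n_def)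
  finally have "degree_dev V F D \<le> real k * D ^ 3 + (real k + 1) / 2 * real (card V) * D"
    by (simp add: n_def power2_eq_square power3_eq_cube algebra_simps add_divide_distrib)
  with FE deg_F show ?thesis
    using that by blast
qed

section \<open>Degree losses caused by selecting an edge\<close>

text \<open>By linearity, \<open>f \<inter> e\<close> has at most one element if \<open>v \<in> f - e\<close>; thus \<open>hits v e\<close> is
  the loss of degree of a surviving vertex \<open>v\<close> when \<open>e\<close> is selected.\<close>

definition hits :: "'a \<Rightarrow> 'a set \<Rightarrow> real" where
  "hits v e = (if v \<in> e then 0 else \<Sum>f | f \<in> E \<and> v \<in> f. real (card (f \<inter> e)))"

lemma hits_nonneg: "0 \<le> hits v e"
  by (auto simp: hits_def intro: sum_nonneg)

text \<open>If v lies outside e, the edges through v are disjoint outside v, so they meet e in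
  disjoint sets.\<close>

lemma hits_le:
  assumes "e \<in> E"
  shows "hits v e \<le> real k"
proof (cases "v \<in> e")
  case False
  let ?g = "\<lambda>x. if x \<in> e then 1 else 0 :: real"
  have "hits v e = (\<Sum>f | f \<in> E \<and> v \<in> f. \<Sum>x\<in>f. ?g x)"
    using False finite_edge by (auto simp: hits_def sum.If_cases intro!: sum.cong)
  also have "\<dots> \<le> (\<Sum>x\<in>V. ?g x)"
    using False by (intro star_sum_le) auto
  also have "\<dots> = real k"
    using assms edges_subset edge_card finite_vertices by (simp add: sum.If_cases Int_absorb1)
  finally show ?thesis .
qed (simp add: hits_def)

lemma degree_remove_edge:
  assumes "e \<in> E" "v \<notin> e"
  shows "real (degree {f \<in> E. f \<inter> e = {}} v) = real (degree E v) - hits v e"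
proof -
  let ?S = "{f \<in> E. v \<in> f}"
  have fin: "finite ?S"
    using finite_edges by simp
  have *: "real (card (f \<inter> e)) = 1 - (if f \<inter> e = {} then 1 else 0)" if "f \<in> ?S" for f
  proof (cases "f \<inter> e = {}")
    case False
    have "card (f \<inter> e) \<le> 1"
      using that assms edges_share_at_most_one[of f e] by auto
    moreover have "card (f \<inter> e) \<noteq> 0"
      using False assms finite_edge by (simp add: card_eq_0_iff)
    ultimately show ?thesis
      using False by simp
  qed simp
  have "hits v e = (\<Sum>f\<in>?S. 1 - (if f \<inter> e = {} then 1 else 0))"
    using assms * by (simp add: hits_def)
  also have "\<dots> = real (degree E v) - real (card (?S \<inter> {f. f \<inter> e = {}}))"
    using fin by (simp add: sum_subtractf sum.If_cases degree_def)
  also have "?S \<inter> {f. f \<inter> e = {}} = {f \<in> {f \<in> E. f \<inter> e = {}}. v \<in> f}"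
    by auto
  finally show ?thesis
    by (simp add: degree_def)
qed

text \<open>Double counting over a common vertex x of f and e. For x \<noteq> v in f, linearity
  makes f the only edge through both v and x, so all but one of the edges at x avoid v.\<close>

lemma sum_hits:
  "(\<Sum>e\<in>E. hits v e) = (\<Sum>f | f \<in> E \<and> v \<in> f. \<Sum>x\<in>f - {v}. real (degree E x) - 1)"
proof -
  let ?N = "{e \<in> E. v \<notin> e}"
  have "(\<Sum>e\<in>E. hits v e) = (\<Sum>e\<in>?N. \<Sum>f | f \<in> E \<and> v \<in> f. real (card (f \<inter> e)))"
    using finite_edges by (intro sum.mono_neutral_cong_right) (auto simp: hits_def)
  also have "\<dots> = (\<Sum>f | f \<in> E \<and> v \<in> f. \<Sum>e\<in>?N. real (card (f \<inter> e)))"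
    by (rule sum.swap)
  also have "\<dots> = (\<Sum>f | f \<in> E \<and> v \<in> f. \<Sum>x\<in>f - {v}. real (degree E x) - 1)"
  proof (rule sum.cong)
    fix f assume "f \<in> {f \<in> E. v \<in> f}"
    then have f: "f \<in> E" "v \<in> f"
      by auto
    have "(\<Sum>e\<in>?N. real (card (f \<inter> e))) = (\<Sum>e\<in>?N. \<Sum>x\<in>f. if x \<in> e then 1 else 0)"
      using finite_edge[OF f(1)] by (simp add: sum.If_cases)
    also have "\<dots> = (\<Sum>x\<in>f. \<Sum>e\<in>?N. if x \<in> e then 1 else 0)"
      by (rule sum.swap)
    also have "\<dots> = (\<Sum>x\<in>f. real (card {e \<in> ?N. x \<in> e}))"
      using finite_edges by (simp flip: sum.inter_filter)
    also have "\<dots> = (\<Sum>x\<in>f - {v}. real (card {e \<in> ?N. x \<in> e}))"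
    proof -
      have "{e \<in> ?N. v \<in> e} = {}"
        by simp
      then show ?thesis
        by (simp only: sum.remove[OF finite_edge[OF f(1)] f(2)] card.empty)
    qed
    also have "\<dots> = (\<Sum>x\<in>f - {v}. real (degree E x) - 1)"
    proof (rule sum.cong)
      fix x assume x: "x \<in> f - {v}"
      have "{e \<in> ?N. x \<in> e} = {e \<in> E. x \<in> e} - {f}"
      proof -
        have "e = f" if "e \<in> E" "v \<in> e" "x \<in> e" for e
          using edge_unique[OF that(1) f(1) that(2,3) f(2)] x by blast
        then show ?thesis
          using f x by blast
      qed
      moreover have "Suc (card ({e \<in> E. x \<in> e} - {f})) = degree E x"
        unfolding degree_def using finite_edges f x by (intro card_Suc_Diff1) auto
      ultimately show "real (card {e \<in> ?N. x \<in> e}) = real (degree E x) - 1"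
        by simp
    qed simp
    finally show "(\<Sum>e\<in>?N. real (card (f \<inter> e))) = (\<Sum>x\<in>f - {v}. real (degree E x) - 1)" .
  qed simp
  finally show ?thesis .
qed

text \<open>Also controls the sum of the squares of \<open>hits\<close>, because \<open>hits\<close>
  is at most k.\<close>

lemma sum_hits_le:
  assumes "k \<ge> 1" and deg: "\<And>v. v \<in> V \<Longrightarrow> real (degree E v) \<le> A"
  shows "(\<Sum>v\<in>V. \<Sum>e\<in>E. hits v e) \<le> real k * (real k - 1) * A * real (card E)"
proof -
  have "(\<Sum>v\<in>V. \<Sum>e\<in>E. hits v e) = (\<Sum>f\<in>E. \<Sum>v\<in>f. \<Sum>x\<in>f - {v}. real (degree E x) - 1)"
    by (simp only: sum_hits sum_incidences)
  also have "\<dots> \<le> real (card E) * (real k * ((real k - 1) * A))"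
  proof (rule sum_bounded_above)
    fix f assume f: "f \<in> E"
    have "(\<Sum>x\<in>f - {v}. real (degree E x) - 1) \<le> (real k - 1) * A" if "v \<in> f" for v
    proof -
      have "real (degree E x) - 1 \<le> A" if "x \<in> f - {v}" for x
        using deg[of x] edges_subset[OF f] that by force
      then have "(\<Sum>x\<in>f - {v}. real (degree E x) - 1) \<le> real (card (f - {v})) * A"
        by (rule sum_bounded_above)
      then show ?thesis
        using f that finite_edge edge_card assms(1) by (simp add: card_Diff_singleton of_nat_diff)
    qed
    then show "(\<Sum>v\<in>f. \<Sum>x\<in>f - {v}. real (degree E x) - 1) \<le> real k * ((real k - 1) * A)"
      using sum_bounded_above[of f _ "(real k - 1) * A"] edge_card[OF f] by simp
  qed
  finally show ?thesis
    by (simp add: mult_ac)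
qed

text \<open>Bounds the cross term that enters the expanded deviation with factor -2. An edge
  \<open>f\<close> contributes
  \<open>(?\<Delta> f)\<^sup>2 + (k - 1) * (t - 1) * ?\<Delta> f\<close> minus its squared
  deviations; the first square is dropped, and summing the last part weights each squared deviation
  by a degree, at most \<open>A\<close>.\<close>

lemma sum_dev_hits_ge:
  assumes deg: "\<And>v. v \<in> V \<Longrightarrow> real (degree E v) \<le> A"
  defines "\<delta> \<equiv> \<lambda>t v. real (degree E v) - t"
  shows "(\<Sum>v\<in>V. \<delta> t v * (\<Sum>e\<in>E. hits v e))
    \<ge> (real k - 1) * (t - 1) * (degree_dev V E t + t * (\<Sum>v\<in>V. \<delta> t v)) - A * degree_dev V E t"
proof -
  let ?\<Delta> = "\<lambda>f. \<Sum>x\<in>f. \<delta> t x" and ?d = "\<lambda>v. real (degree E v)"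
  have "(\<Sum>v\<in>V. \<delta> t v * (\<Sum>e\<in>E. hits v e))
      = (\<Sum>f\<in>E. \<Sum>v\<in>f. \<delta> t v * (\<Sum>x\<in>f - {v}. real (degree E x) - 1))"
    by (simp only: sum_hits sum_distrib_left sum_incidences)
  also have "\<dots> = (\<Sum>f\<in>E. (?\<Delta> f)\<^sup>2 + (real k - 1) * (t - 1) * ?\<Delta> f - (\<Sum>v\<in>f. (\<delta> t v)\<^sup>2))"
  proof (rule sum.cong)
    fix f assume f: "f \<in> E"
    have "(\<Sum>v\<in>f. \<delta> t v * (\<Sum>x\<in>f - {v}. real (degree E x) - 1))
        = (\<Sum>v\<in>f. (?\<Delta> f + (real k - 1) * (t - 1)) * \<delta> t v - (\<delta> t v)\<^sup>2)"
    proof (rule sum.cong)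
      fix v assume v: "v \<in> f"
      have "(\<Sum>x\<in>f - {v}. real (degree E x) - 1) = (\<Sum>x\<in>f. \<delta> t x + (t - 1)) - (\<delta> t v + (t - 1))"
        using sum.remove[OF finite_edge[OF f] v, of "\<lambda>x. real (degree E x) - 1"] by (simp add: \<delta>_def)
      also have "\<dots> = ?\<Delta> f + (real k - 1) * (t - 1) - \<delta> t v"
        unfolding sum.distrib sum_constant edge_card[OF f] by (simp add: algebra_simps)
      finally have eq: "(\<Sum>x\<in>f - {v}. real (degree E x) - 1) = ?\<Delta> f + (real k - 1) * (t - 1) - \<delta> t v" .
      show "\<delta> t v * (\<Sum>x\<in>f - {v}. real (degree E x) - 1)
          = (?\<Delta> f + (real k - 1) * (t - 1)) * \<delta> t v - (\<delta> t v)\<^sup>2"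
        unfolding eq by (simp add: power2_eq_square algebra_simps)
    qed simp
    also have "\<dots> = (?\<Delta> f + (real k - 1) * (t - 1)) * ?\<Delta> f - (\<Sum>v\<in>f. (\<delta> t v)\<^sup>2)"
      by (simp add: sum_subtractf sum_distrib_left)
    finally show "(\<Sum>v\<in>f. \<delta> t v * (\<Sum>x\<in>f - {v}. real (degree E x) - 1))
        = (?\<Delta> f)\<^sup>2 + (real k - 1) * (t - 1) * ?\<Delta> f - (\<Sum>v\<in>f. (\<delta> t v)\<^sup>2)"
      by (simp add: power2_eq_square algebra_simps)
  qed simp
  also have "\<dots> \<ge> (\<Sum>f\<in>E. (real k - 1) * (t - 1) * ?\<Delta> f - (\<Sum>v\<in>f. (\<delta> t v)\<^sup>2))"
    by (intro sum_mono) simp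
  also have "(\<Sum>f\<in>E. (real k - 1) * (t - 1) * ?\<Delta> f - (\<Sum>v\<in>f. (\<delta> t v)\<^sup>2))
      = (real k - 1) * (t - 1) * (\<Sum>v\<in>V. \<delta> t v * ?d v) - (\<Sum>v\<in>V. (\<delta> t v)\<^sup>2 * ?d v)"
    by (simp add: sum_degree_weighted sum_subtractf sum_distrib_left)
  also have "(\<Sum>v\<in>V. \<delta> t v * ?d v) = degree_dev V E t + t * (\<Sum>v\<in>V. \<delta> t v)"
    unfolding degree_dev_def sum_distrib_left sum.distrib[symmetric]
    by (intro sum.cong) (auto simp: \<delta>_def power2_eq_square algebra_simps)
  finally have "(\<Sum>v\<in>V. \<delta> t v * (\<Sum>e\<in>E. hits v e))
      \<ge> (real k - 1) * (t - 1) * (degree_dev V E t + t * (\<Sum>v\<in>V. \<delta> t v)) - (\<Sum>v\<in>V. (\<delta> t v)\<^sup>2 * ?d v)" .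
  moreover have "(\<Sum>v\<in>V. (\<delta> t v)\<^sup>2 * ?d v) \<le> A * degree_dev V E t"
    unfolding degree_dev_def sum_distrib_left
  proof (rule sum_mono)
    fix v assume "v \<in> V"
    then show "(\<delta> t v)\<^sup>2 * ?d v \<le> A * (?d v - t)\<^sup>2"
      using mult_right_mono[OF deg, of v "(\<delta> t v)\<^sup>2"] by (simp add: \<delta>_def mult.commute)
  qed
  ultimately show ?thesis
    by linarith
qed

section \<open>One greedy step, by averaging over all edges\<close>

lemma greedy_step:
  assumes k: "k \<ge> 2" and "V \<noteq> {}" and t: "1 \<le> t" "t \<le> A" "t \<le> real (card V)"
    and deg: "\<And>v. v \<in> V \<Longrightarrow> real (degree E v) \<le> A"
    and dev: "degree_dev V E t \<le> real (card V) * t\<^sup>2 / 4"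
  obtains e where "e \<in> E"
    "degree_dev (V - e) {f \<in> E. f \<inter> e = {}} (t - real k * (real k - 1) * t / real (card V))
      \<le> (1 + 6 * real k ^ 2 * A / (real (card V) * t)) * degree_dev V E t + 4 * real k ^ 4 * A"
proof -
  define m where "m = real (card V)"
  define S where "S = real (card E)"
  \<comment> \<open>Approximately the expected loss of degree in the t-regular case: about (k - 1) *
    t^2 pairs of an edge at v and an edge hitting it, divided by m * t / k edges.\<close>
  define \<tau> where "\<tau> = real k * (real k - 1) * t / m"
  define \<Phi> where "\<Phi> = degree_dev V E t"
  define \<delta> where "\<delta> = (\<lambda>v. real (degree E v) - t)"
  define \<Delta> where "\<Delta> = (\<Sum>v\<in>V. \<delta> v)"
  define \<Phi>' where "\<Phi>' = (\<lambda>e. degree_dev (V - e) {f \<in> E. f \<inter> e = {}} (t - \<tau>))"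
  let ?C = "\<lambda>v. \<Sum>e\<in>E. hits v e"
  have m: "m > 0"
    using \<open>V \<noteq> {}\<close> finite_vertices by (simp add: m_def card_gt_0_iff)
  have \<tau>: "\<tau> \<ge> 0"
    using k t m by (simp add: \<tau>_def)
  have \<Phi>: "\<Phi> \<ge> 0" "\<Phi> = (\<Sum>v\<in>V. (\<delta> v)\<^sup>2)"
    by (auto simp: \<Phi>_def \<delta>_def degree_dev_def intro: sum_nonneg)
  have kS: "real k * S = m * t + \<Delta>"
    using sum_degree by (simp add: \<Delta>_def \<delta>_def S_def m_def sum_subtractf)
  \<comment> \<open>The Cauchy-Schwarz inequality, obtained from the nonnegativity of the
    variance.\<close>
  have \<Delta>: "\<Delta>\<^sup>2 \<le> m * \<Phi>"
  proof -
    have "0 \<le> (\<Sum>v\<in>V. (\<delta> v - \<Delta> / m)\<^sup>2)"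
      by (intro sum_nonneg) simp
    also have "\<dots> = (\<Sum>v\<in>V. (\<delta> v)\<^sup>2 - 2 * (\<Delta> / m) * \<delta> v + (\<Delta> / m)\<^sup>2)"
      by (intro sum.cong) (auto simp: power2_diff)
    also have "\<dots> = \<Phi> - 2 * (\<Delta> / m) * \<Delta> + m * (\<Delta> / m)\<^sup>2"
      unfolding sum.distrib sum_subtractf sum_distrib_left[symmetric] sum_constant \<Phi>(2) \<Delta>_def m_def ..
    also have "\<dots> = \<Phi> - \<Delta>\<^sup>2 / m"
      using m by (simp add: power2_eq_square field_simps)
    finally show ?thesis
      using m by (simp add: field_simps)
  qed
  have "\<Delta>\<^sup>2 \<le> (m * t / 2)\<^sup>2"
  proof -
    have "m * \<Phi> \<le> m * (m * t\<^sup>2 / 4)"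
      using dev m by (intro mult_left_mono) (auto simp: \<Phi>_def m_def)
    then show ?thesis
      using \<Delta> by (simp add: power2_eq_square algebra_simps)
  qed
  then have "\<bar>\<Delta>\<bar> \<le> m * t / 2"
    using m t by (simp add: abs_le_square_iff[symmetric])
  \<comment> \<open>At least half as many edges as in the t-regular case are present.\<close>
  then have S_lower: "2 * real k * S \<ge> m * t"
    using kS by linarith
  then have S: "S > 0"
    using m t k by (smt (verit) mult_nonneg_nonpos mult_pos_pos of_nat_0_le_iff)
  \<comment> \<open>The deleted vertices are put back, which only adds squares and makes the index
    set independent of \<open>e\<close>.\<close>
  have \<Phi>'_le: "\<Phi>' e \<le> (\<Sum>v\<in>V. (\<delta> v + \<tau> - hits v e)\<^sup>2)" if "e \<in> E" for e
  proof -
    have "\<Phi>' e = (\<Sum>v\<in>V - e. (\<delta> v + \<tau> - hits v e)\<^sup>2)"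
      unfolding \<Phi>'_def degree_dev_def \<delta>_def
      by (intro sum.cong) (auto simp: degree_remove_edge[OF that] algebra_simps)
    also have "\<dots> \<le> (\<Sum>v\<in>V. (\<delta> v + \<tau> - hits v e)\<^sup>2)"
      by (intro sum_mono2 finite_vertices) auto
    finally show ?thesis .
  qed
  have "(\<Sum>e\<in>E. \<Phi>' e) \<le> (\<Sum>e\<in>E. \<Sum>v\<in>V. (\<delta> v + \<tau> - hits v e)\<^sup>2)"
    by (intro sum_mono \<Phi>'_le)
  also have "\<dots> \<le> (\<Sum>e\<in>E. \<Sum>v\<in>V. (\<delta> v + \<tau>)\<^sup>2 - 2 * \<delta> v * hits v e + real k * hits v e)"
  proof (intro sum_mono)
    fix e v assume "e \<in> E" "v \<in> V"
    have "(hits v e)\<^sup>2 \<le> real k * hits v e"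
      unfolding power2_eq_square using hits_le[OF \<open>e \<in> E\<close>] hits_nonneg by (intro mult_right_mono)
    moreover have "0 \<le> \<tau> * hits v e"
      using \<tau> hits_nonneg by simp
    ultimately show "(\<delta> v + \<tau> - hits v e)\<^sup>2 \<le> (\<delta> v + \<tau>)\<^sup>2 - 2 * \<delta> v * hits v e + real k * hits v e"
      by (simp add: power2_eq_square algebra_simps)
  qed
  also have "\<dots> = (\<Sum>v\<in>V. \<Sum>e\<in>E. (\<delta> v + \<tau>)\<^sup>2 - 2 * \<delta> v * hits v e + real k * hits v e)"
    by (rule sum.swap)
  also have "\<dots> = S * (\<Sum>v\<in>V. (\<delta> v + \<tau>)\<^sup>2) - 2 * (\<Sum>v\<in>V. \<delta> v * ?C v) + real k * (\<Sum>v\<in>V. ?C v)"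
    by (simp add: sum.distrib sum_subtractf sum_distrib_left S_def mult_ac)
  also have "(\<Sum>v\<in>V. (\<delta> v + \<tau>)\<^sup>2) = \<Phi> + 2 * \<tau> * \<Delta> + m * \<tau>\<^sup>2"
  proof -
    have "(\<Sum>v\<in>V. (\<delta> v + \<tau>)\<^sup>2) = (\<Sum>v\<in>V. (\<delta> v)\<^sup>2 + 2 * \<tau> * \<delta> v + \<tau>\<^sup>2)"
      by (intro sum.cong) (auto simp: power2_sum)
    then show ?thesis
      unfolding sum.distrib sum_distrib_left[symmetric] sum_constant \<Phi>(2) \<Delta>_def m_def .
  qed
  finally have "(\<Sum>e\<in>E. \<Phi>' e) \<le> S * (\<Phi> + 2 * \<tau> * \<Delta> + m * \<tau>\<^sup>2)
      - 2 * (\<Sum>v\<in>V. \<delta> v * ?C v) + real k * (\<Sum>v\<in>V. ?C v)" .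
  moreover have "- 2 * (\<Sum>v\<in>V. \<delta> v * ?C v) \<le> - 2 * ((real k - 1) * (t - 1) * (\<Phi> + t * \<Delta>) - A * \<Phi>)"
    using sum_dev_hits_ge[OF deg, of t] by (simp add: \<delta>_def \<Phi>_def \<Delta>_def)
  moreover have "real k * (\<Sum>v\<in>V. ?C v) \<le> real k * (real k * (real k - 1) * A * S)"
    using sum_hits_le[OF _ deg] k by (intro mult_left_mono) (auto simp: S_def)
  ultimately have total: "(\<Sum>e\<in>E. \<Phi>' e) \<le> S * (\<Phi> + 2 * \<tau> * \<Delta> + m * \<tau>\<^sup>2)
      - 2 * ((real k - 1) * (t - 1) * (\<Phi> + t * \<Delta>) - A * \<Phi>) + real k * (real k * (real k - 1) * A * S)"
    by linarith
  \<comment> \<open>This choice of \<tau> makes the terms of order t^2 * \<Delta> cancel, since k *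
    S / m equals t up to \<Delta> / m. What remains is of order t times \<Phi> or \<Delta>.\<close>
  have "S * (2 * \<tau> * \<Delta>) = 2 * (real k - 1) * t * (real k * S / m) * \<Delta>"
    by (simp add: \<tau>_def mult_ac)
  also have "real k * S / m = t + \<Delta> / m"
    using kS m by (simp add: field_simps)
  finally have cross: "S * (2 * \<tau> * \<Delta>) - 2 * ((real k - 1) * (t - 1) * (\<Phi> + t * \<Delta>))
      = 2 * (real k - 1) * t * (\<Delta>\<^sup>2 / m) + (real k - 1) * t * (2 * \<Delta>) - 2 * (real k - 1) * (t - 1) * \<Phi>"
    using m by (simp add: power2_eq_square field_simps)
  have "\<Delta>\<^sup>2 / m \<le> \<Phi>"
    using \<Delta> m by (simp add: field_simps)
  then have "(real k - 1) * t * (\<Delta>\<^sup>2 / m) \<le> (real k - 1) * t * \<Phi>"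
    using k t by (intro mult_left_mono) auto
  moreover have "2 * \<Delta> \<le> \<Phi> + m"
  proof -
    have "2 * \<Delta> \<le> \<Delta>\<^sup>2 / m + m"
      using m zero_le_power2[of "\<Delta> - m"] by (simp add: field_simps power2_eq_square)
    then show ?thesis
      using \<open>\<Delta>\<^sup>2 / m \<le> \<Phi>\<close> by linarith
  qed
  then have "(real k - 1) * t * (2 * \<Delta>) \<le> (real k - 1) * t * (\<Phi> + m)"
    using k t by (intro mult_left_mono) auto
  moreover have "0 \<le> 2 * (real k - 1) * (t - 1) * \<Phi>"
    using k t \<Phi> by simp
  ultimately have "(\<Sum>e\<in>E. \<Phi>' e) \<le> S * \<Phi> + (3 * (real k - 1) * t + 2 * A) * \<Phi> + (real k - 1) * t * m
      + S * (m * \<tau>\<^sup>2) + real k * (real k * (real k - 1) * A * S)"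
    using total cross by (simp only: distrib_left distrib_right left_diff_distrib right_diff_distrib)
  also have "(3 * (real k - 1) * t + 2 * A) * \<Phi> \<le> (3 * real k * A) * \<Phi>"
  proof (intro mult_right_mono \<Phi>)
    have "(real k - 1) * t \<le> (real k - 1) * A"
      using k t by (intro mult_left_mono) auto
    then show "3 * (real k - 1) * t + 2 * A \<le> 3 * real k * A"
      using t by (simp add: algebra_simps)
  qed
  \<comment> \<open>The factor m * t is isolated so that \<open>S_lower\<close> can trade it for a
    multiple of \<open>S\<close>; a bound proportional to the number of edges is needed for
    averaging.\<close>
  also have "\<dots> = (3 * real k * A * \<Phi> / (m * t)) * (m * t)"
    using m t by simp
  also have "\<dots> \<le> (3 * real k * A * \<Phi> / (m * t)) * (2 * real k * S)"
    using S_lower m t \<Phi> by (intro mult_left_mono) auto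
  also have "(real k - 1) * t * m \<le> (real k - 1) * (2 * real k * S)"
    using S_lower k mult_left_mono[of "m * t" "2 * real k * S" "real k - 1"] by (simp add: mult_ac)
  also have "S * (m * \<tau>\<^sup>2) \<le> S * (real k ^ 4 * A)"
  proof (intro mult_left_mono)
    have "m * \<tau>\<^sup>2 = (real k * (real k - 1))\<^sup>2 * (t * (t / m))"
      using m by (simp add: \<tau>_def power2_eq_square field_simps)
    also have "\<dots> \<le> (real k * real k)\<^sup>2 * (A * 1)"
      using k t m by (intro mult_mono power_mono) (auto simp: m_def)
    also have "\<dots> = real k ^ 4 * A"
      by (simp add: power4_eq_xxxx power2_eq_square)
    finally show "m * \<tau>\<^sup>2 \<le> real k ^ 4 * A" .
  qed (use S in simp)
  finally have "(\<Sum>e\<in>E. \<Phi>' e) \<le> S * (\<Phi> + 6 * real k ^ 2 * A / (m * t) * \<Phi>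
      + (2 * real k * (real k - 1) + real k ^ 4 * A + real k ^ 2 * (real k - 1) * A))"
    by (simp add: algebra_simps power2_eq_square)
  also have "\<dots> \<le> S * (\<Phi> + 6 * real k ^ 2 * A / (m * t) * \<Phi> + 4 * real k ^ 4 * A)"
  proof (intro mult_left_mono add_left_mono)
    have "2 * real k * (real k - 1) \<le> real k ^ 4 * A"
    proof -
      have "2 * real k * (real k - 1) \<le> real k * real k * real k"
        using k by (intro mult_mono) auto
      also have "\<dots> = real k ^ 3 * 1"
        by (simp add: power3_eq_cube)
      also have "\<dots> \<le> real k ^ 4 * A"
        using k t by (intro mult_mono power_increasing) auto
      finally show ?thesis .
    qed
    moreover have "real k ^ 2 * (real k - 1) * A \<le> real k ^ 4 * A"
    proof (intro mult_right_mono)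
      have "real k ^ 2 * (real k - 1) \<le> real k ^ 2 * real k"
        by (intro mult_left_mono) auto
      also have "\<dots> \<le> real k ^ 4"
        using k power_increasing[of 3 4 "real k"] by (simp add: power2_eq_square power3_eq_cube)
      finally show "real k ^ 2 * (real k - 1) \<le> real k ^ 4" .
    qed (use t in simp)
    moreover have "0 \<le> real k ^ 4 * A"
      using t by simp
    ultimately show "2 * real k * (real k - 1) + real k ^ 4 * A + real k ^ 2 * (real k - 1) * A
        \<le> 4 * real k ^ 4 * A"
      by linarith
  qed (use S in simp)
  finally have bound: "(\<Sum>e\<in>E. \<Phi>' e) \<le> S * (\<Phi> + 6 * real k ^ 2 * A / (m * t) * \<Phi> + 4 * real k ^ 4 * A)" .
  have "\<exists>e\<in>E. \<Phi>' e \<le> \<Phi> + 6 * real k ^ 2 * A / (m * t) * \<Phi> + 4 * real k ^ 4 * A"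
  proof (rule ccontr)
    assume "\<not> ?thesis"
    then have "(\<Sum>e\<in>E. \<Phi> + 6 * real k ^ 2 * A / (m * t) * \<Phi> + 4 * real k ^ 4 * A) < (\<Sum>e\<in>E. \<Phi>' e)"
      using S finite_edges by (intro sum_strict_mono) (auto simp: S_def)
    then show False
      using bound by (simp add: S_def)
  qed
  then show ?thesis
    using that by (auto simp: \<Phi>'_def \<Phi>_def \<tau>_def m_def algebra_simps)
qed

section \<open>Iterating the greedy step\<close>

text \<open>While at least \<epsilon> * n vertices remain, \<open>x\<close> bounds the relative loss
  of the target per step and \<open>K / n\<close> the relative growth of the deviation. Over at most
  n steps the target stays above \<kappa> * D and the growth factor below exp K, so the hypothesis
  on the deviation keeps every step applicable.\<close>

lemma greedy_matching:
  fixes \<epsilon> D A \<kappa> :: real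
  defines "n \<equiv> real (card V)"
  defines "x \<equiv> real k * (real k - 1) / (\<epsilon> * n)"
  defines "K \<equiv> 6 * real k ^ 2 * A / (\<epsilon> * \<kappa> * D)"
  assumes k: "k \<ge> 2" and "V \<noteq> {}" and \<epsilon>: "0 < \<epsilon>" "\<epsilon> < 1"
    and deg: "\<And>v. v \<in> V \<Longrightarrow> real (degree E v) \<le> A" and D: "D \<le> A" "D \<le> \<epsilon> * n" "1 \<le> \<kappa> * D"
    and \<kappa>: "0 < \<kappa>" "\<kappa> \<le> (1 - x) ^ card V" and x: "x \<le> 1"
    and dev: "exp K * (degree_dev V E D + n * (4 * real k ^ 4 * A)) \<le> \<epsilon> * n * (\<kappa> * D)\<^sup>2 / 4"
  shows "\<exists>M. matching E M \<and> (1 - \<epsilon>) * n \<le> real (card (covered_vertices M))"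
proof -
  define c where "c = 4 * real k ^ 4 * A"
  define \<Phi> where "\<Phi> = degree_dev V E D"
  have n: "n > 0"
    using \<open>V \<noteq> {}\<close> finite_vertices by (simp add: n_def card_gt_0_iff)
  have D0: "D > 0"
    using D(3) \<kappa>(1) by (smt (verit) mult_nonneg_nonpos)
  have nonneg: "0 \<le> c" "0 \<le> \<Phi>" "0 \<le> K" "0 \<le> x"
    using D(1) D0 \<kappa> \<epsilon> n k by (auto simp: c_def \<Phi>_def K_def x_def degree_dev_def intro!: sum_nonneg)
  have card_matching: "card (\<Union>M) = k * card M" if "M \<subseteq> E" "pairwise disjnt M" for M
  proof -
    have "card (\<Union>M) = sum card M"
      using that finite_edge by (intro card_Union_disjoint) auto
    also have "\<dots> = sum (\<lambda>_. k) M"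
      using that edge_card by (intro sum.cong) auto
    finally show ?thesis
      by simp
  qed
  \<comment> \<open>The premise asks for uncovered room only before each of the \<open>i\<close>
    steps, so the last step may pass the threshold.\<close>
  have greedy: "\<exists>M t. M \<subseteq> E \<and> pairwise disjnt M \<and> card M = i \<and> D * (1 - x) ^ i \<le> t \<and> t \<le> D \<and>
      degree_dev (V - \<Union>M) {f \<in> E. f \<inter> \<Union>M = {}} t \<le> (1 + K / n) ^ i * (\<Phi> + real i * c)"
    if "\<And>j. j < i \<Longrightarrow> real (k * j) < (1 - \<epsilon>) * n" for i
    using that
  proof (induction i)
    case 0
    show ?case
      by (intro exI[of _ "{}"] exI[of _ D]) (simp add: \<Phi>_def)
  next
    case (Suc i)
    from Suc.IH[OF Suc.prems[OF less_SucI]]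
    obtain M t where M: "M \<subseteq> E" "pairwise disjnt M" "card M = i"
      and t: "D * (1 - x) ^ i \<le> t" "t \<le> D"
      and dev_i: "degree_dev (V - \<Union>M) {f \<in> E. f \<inter> \<Union>M = {}} t \<le> (1 + K / n) ^ i * (\<Phi> + real i * c)"
      by blast
    define W where "W = V - \<Union>M"
    define G where "G = {f \<in> E. f \<inter> \<Union>M = {}}"
    define m where "m = real (card W)"
    interpret G: linear_k_graph W G k
      using edges_subset by (intro subgraph) (auto simp: W_def G_def)
    have "\<Union>M \<subseteq> V"
      using M(1) edges_subset by blast
    moreover from this have "finite (\<Union>M)"
      using finite_vertices finite_subset by blast
    ultimately have "card W = card V - k * i"
      using card_matching[OF M(1,2)] M(3) by (simp add: W_def card_Diff_subset)
    then have "n - real (k * i) \<le> m"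
      unfolding m_def n_def by linarith
    moreover have ki: "real (k * i) < (1 - \<epsilon>) * n"
      using Suc.prems by blast
    ultimately have m: "\<epsilon> * n \<le> m"
      by (simp add: left_diff_distrib)
    then have m0: "m > 0"
      using \<epsilon> n by (smt (verit) mult_pos_pos)
    have "real i \<le> real (k * i)"
      using k mult_right_mono[of 1 "real k" "real i"] by simp
    also have "\<dots> \<le> n"
      using ki \<epsilon> n by (smt (verit) mult_less_cancel_right2)
    finally have i: "i \<le> card V"
      by (simp add: n_def)
    have "\<kappa> \<le> (1 - x) ^ i"
      using \<kappa>(2) power_decreasing[OF i, of "1 - x"] nonneg x by linarith
    then have t_lower: "\<kappa> * D \<le> t"
      using t(1) D0 by (smt (verit) mult.commute mult_right_mono)
    have t0: "t > 0"
      using t_lower D(3) by linarith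
    have "(1 + K / n) ^ i \<le> exp K"
    proof -
      have "(1 + K / n) ^ i \<le> (1 + K / n) ^ card V"
        using i nonneg n by (intro power_increasing) auto
      also have "\<dots> \<le> exp (K / n) ^ card V"
        using nonneg n by (intro power_mono exp_ge_add_one_self) auto
      also have "\<dots> = exp K"
        using n by (simp add: exp_of_nat_mult[symmetric] n_def)
      finally show ?thesis .
    qed
    moreover have "\<Phi> + real i * c \<le> \<Phi> + n * c"
      using i nonneg by (auto simp: n_def intro: mult_right_mono)
    ultimately have "(1 + K / n) ^ i * (\<Phi> + real i * c) \<le> exp K * (\<Phi> + n * c)"
      using nonneg by (intro mult_mono) auto
    also have "\<dots> \<le> \<epsilon> * n * (\<kappa> * D)\<^sup>2 / 4"
      using dev by (simp add: \<Phi>_def c_def)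
    also have "\<dots> \<le> m * t\<^sup>2 / 4"
      using m t_lower \<epsilon> n \<kappa>(1) D0 m0 by (intro divide_right_mono mult_mono power_mono) auto
    finally have "degree_dev W G t \<le> real (card W) * t\<^sup>2 / 4"
      using dev_i by (simp add: W_def G_def m_def)
    moreover have "W \<noteq> {}"
      using m0 by (auto simp: m_def)
    moreover have "real (degree G v) \<le> A" if "v \<in> W" for v
    proof -
      have "degree G v \<le> degree E v"
        unfolding degree_def using finite_edges by (intro card_mono) (auto simp: G_def)
      then show ?thesis
        using deg[of v] that by (simp add: W_def)
    qed
    moreover have "1 \<le> t" "t \<le> A" "t \<le> real (card W)"
      using t_lower t D m by (auto simp: m_def)
    ultimately obtain e where e: "e \<in> G"
      and dev_e: "degree_dev (W - e) {f \<in> G. f \<inter> e = {}} (t - real k * (real k - 1) * t / m)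
        \<le> (1 + 6 * real k ^ 2 * A / (m * t)) * degree_dev W G t + 4 * real k ^ 4 * A"
      using G.greedy_step[OF k, of t A] unfolding m_def by blast
    define t' where "t' = t - real k * (real k - 1) * t / m"
    have "t' = t * (1 - real k * (real k - 1) / m)"
      by (simp add: t'_def algebra_simps)
    moreover have "real k * (real k - 1) / m \<le> x"
      unfolding x_def using m \<epsilon> n k m0 by (intro divide_left_mono mult_pos_pos) auto
    ultimately have "t * (1 - x) \<le> t'"
      using t0 by simp
    moreover have "D * (1 - x) ^ i * (1 - x) \<le> t * (1 - x)"
      using t(1) x by (intro mult_right_mono) auto
    ultimately have t'_lower: "D * (1 - x) ^ Suc i \<le> t'"
      by (simp add: mult_ac)
    have t'_upper: "t' \<le> D"
    proof -
      have "0 \<le> real k * (real k - 1) * t / m"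
        using t0 m0 k by simp
      then show ?thesis
        using t(2) by (simp add: t'_def)
    qed
    have "degree_dev (W - e) {f \<in> G. f \<inter> e = {}} t' \<le> (1 + 6 * real k ^ 2 * A / (m * t)) * degree_dev W G t + c"
      using dev_e by (simp add: t'_def c_def)
    also have "\<dots> \<le> (1 + K / n) * ((1 + K / n) ^ i * (\<Phi> + real i * c)) + 1 * c"
    proof -
      have "6 * real k ^ 2 * A / (m * t) \<le> 6 * real k ^ 2 * A / ((\<epsilon> * n) * (\<kappa> * D))"
        using m t_lower \<epsilon> n \<kappa>(1) D0 D(1) m0 t0
        by (intro divide_left_mono mult_mono mult_pos_pos mult_nonneg_nonneg) auto
      also have "\<dots> = K / n"
        by (simp add: K_def mult_ac)
      finally have "1 + 6 * real k ^ 2 * A / (m * t) \<le> 1 + K / n"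
        by simp
      moreover have "0 \<le> degree_dev W G t"
        by (auto simp: degree_dev_def intro: sum_nonneg)
      ultimately show ?thesis
        using dev_i nonneg n by (auto simp: W_def G_def intro!: mult_mono)
    qed
    also have "1 * c \<le> (1 + K / n) ^ Suc i * c"
      using nonneg n by (intro mult_right_mono one_le_power) auto
    finally have "degree_dev (W - e) {f \<in> G. f \<inter> e = {}} t' \<le> (1 + K / n) ^ Suc i * (\<Phi> + real (Suc i) * c)"
      by (simp add: algebra_simps add_divide_distrib)
    moreover have "W - e = V - \<Union>(insert e M)" "{f \<in> G. f \<inter> e = {}} = {f \<in> E. f \<inter> \<Union>(insert e M) = {}}"
      by (auto simp: W_def G_def)
    moreover have "insert e M \<subseteq> E" "pairwise disjnt (insert e M)"
      using e M(1,2) by (auto simp: G_def pairwise_insert disjnt_def)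
    moreover have "card (insert e M) = Suc i"
    proof -
      \<comment> \<open>Being disjoint from all edges of \<open>M\<close> excludes membership in
        \<open>M\<close> only for a nonempty edge.\<close>
      have "e \<noteq> {}"
        using G.edge_card[OF e] k by auto
      then have "e \<notin> M"
        using e by (auto simp: G_def)
      then show ?thesis
        using M(1,3) finite_subset[OF M(1) finite_edges] by simp
    qed
    ultimately show ?case
      using t'_lower t'_upper by (intro exI[of _ "insert e M"] exI[of _ t']) simp
  qed
  \<comment> \<open>The first number of edges that covers enough; minimality is exactly the premise
    of \<open>greedy\<close>.\<close>
  define i where "i = (LEAST i. (1 - \<epsilon>) * n \<le> real (k * i))"
  have "(1 - \<epsilon>) * n \<le> real (k * card V)"
  proof -
    have "(1 - \<epsilon>) * n \<le> real k * n"
      using \<epsilon> n k by (intro mult_right_mono) auto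
    then show ?thesis
      by (simp add: n_def)
  qed
  then have i: "(1 - \<epsilon>) * n \<le> real (k * i)"
    unfolding i_def by (rule LeastI)
  have "real (k * j) < (1 - \<epsilon>) * n" if "j < i" for j
    using not_less_Least[of j] that unfolding i_def by force
  then obtain M where "M \<subseteq> E" "pairwise disjnt M" "card M = i"
    using greedy by blast
  then show ?thesis
    using i card_matching by (auto simp: matching_def covered_vertices_def)
qed

end

section \<open>Choice of constants and conclusion\<close>

text \<open>With x of order 1/n, this bounds the shrinking of the target below by a constant
  independent of n.\<close>

lemma one_minus_power_ge_exp:
  fixes x :: real
  assumes "0 \<le> x" "x \<le> 1 / 2"
  shows "exp (- 2 * x * real n) \<le> (1 - x) ^ n"
proof -
  have "x * x \<le> x * (1 / 2)"
    using assms by (intro mult_left_mono)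
  then have "- 2 * x \<le> ln (1 - x)"
    using ln_one_minus_pos_lower_bound[OF assms] by (simp add: power2_eq_square)
  then have "exp (- 2 * x) \<le> 1 - x"
    using assms by (simp add: ln_ge_iff)
  then have "exp (- 2 * x) ^ n \<le> (1 - x) ^ n"
    by (intro power_mono) auto
  then show ?thesis
    by (simp add: exp_of_nat_mult[symmetric] mult_ac)
qed

text \<open>The maximum degree is bounded by \<open>B * D\<close>, so the growth exponent
  \<open>K\<close> is free of \<open>D\<close>; all constants can therefore be fixed from \<epsilon>
  and k before D = \<gamma> * n is set.\<close>

lemma linear_k_graph_near_perfect_matching:
  fixes \<epsilon> :: real
  assumes \<epsilon>: "0 < \<epsilon>" "\<epsilon> < 1" and k: "k \<ge> 2"
  obtains n\<^sub>0 :: nat where "n\<^sub>0 > 0"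
    "\<And>(V :: 'a set) E. linear_k_graph V E k \<Longrightarrow> n\<^sub>0 \<le> card V \<Longrightarrow>
      (\<And>v. v \<in> V \<Longrightarrow> real (card V) / real k \<le> real (degree E v)) \<Longrightarrow>
      \<exists>M. matching E M \<and> (1 - \<epsilon>) * real (card V) \<le> real (card (covered_vertices M))"
proof -
  define \<kappa> where "\<kappa> = exp (- 2 * real k * (real k - 1) / \<epsilon>)"
  define B where "B = real k + 1"
  define K where "K = 6 * real k ^ 2 * B / (\<epsilon> * \<kappa>)"
  \<comment> \<open>The deviation allowed at the start, in units of n * D^2, before growth by exp
    K.\<close>
  define b where "b = \<epsilon> * \<kappa>\<^sup>2 / (4 * exp K)"
  \<comment> \<open>Ensures D \<le> \<epsilon> * n and lets k * D^3 use up at most half of the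
    allowance \<open>b\<close>.\<close>
  define \<gamma> where "\<gamma> = min \<epsilon> (b / (2 * real k))"
  \<comment> \<open>A lower bound for \<open>D\<close>: the first summand fits the errors linear in
    D into the other half of \<open>b\<close>, the others give D \<ge> k and \<kappa> * D \<ge>
    1.\<close>
  define L where "L = (B + 8 * real k ^ 4 * B) / b + real k + 1 / \<kappa>"
  \<comment> \<open>The two summands yield D \<ge> L and x \<le> 1/2.\<close>
  define n\<^sub>0 where "n\<^sub>0 = nat \<lceil>L / \<gamma> + 2 * real k ^ 2 / \<epsilon>\<rceil> + 1"
  have pos: "\<kappa> > 0" "B > 0" "b > 0" "\<gamma> > 0"
    using \<epsilon> k by (auto simp: \<kappa>_def B_def b_def \<gamma>_def)
  have L_parts: "(B + 8 * real k ^ 4 * B) / b > 0" "1 / \<kappa> > 0"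
    using pos by (auto intro!: divide_pos_pos add_pos_nonneg)
  then have L: "L > 0"
    unfolding L_def by (intro add_pos_pos add_pos_nonneg) auto
  show ?thesis
  proof
    show "n\<^sub>0 > 0"
      by (simp add: n\<^sub>0_def)
    fix V :: "'a set" and E
    assume "linear_k_graph V E k" and card_V: "n\<^sub>0 \<le> card V"
      and deg: "\<And>v. v \<in> V \<Longrightarrow> real (card V) / real k \<le> real (degree E v)"
    interpret linear_k_graph V E k
      by fact
    define n where "n = real (card V)"
    define D where "D = \<gamma> * n"
    have "L / \<gamma> + 2 * real k ^ 2 / \<epsilon> \<le> n"
      using card_V unfolding n\<^sub>0_def n_def by linarith
    moreover have "0 \<le> L / \<gamma>" "0 \<le> 2 * real k ^ 2 / \<epsilon>"
      using L pos \<epsilon> by auto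
    ultimately have "L / \<gamma> \<le> n" and n2: "2 * real k ^ 2 / \<epsilon> \<le> n"
      by linarith+
    then have D_L: "L \<le> D"
      using pos by (simp add: D_def field_simps)
    have "V \<noteq> {}"
      using card_V by (auto simp: n\<^sub>0_def)
    then have n: "n > 0"
      using finite_vertices by (simp add: n_def card_gt_0_iff)
    have D_parts: "(B + 8 * real k ^ 4 * B) / b \<le> D" "real k \<le> D" "1 / \<kappa> \<le> D"
      using D_L L_parts unfolding L_def by linarith+
    obtain F where F: "F \<subseteq> E" "\<And>v. v \<in> V \<Longrightarrow> real (degree F v) \<le> B * D"
      "degree_dev V F D \<le> real k * D ^ 3 + B / 2 * n * D"
      using nearly_regular_subgraph[OF k \<open>V \<noteq> {}\<close> _ deg, of D] D_parts(2) k
      unfolding B_def n_def by auto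
    interpret F: linear_k_graph V F k
      using F(1) edges_subset by (intro subgraph) auto
    define x where "x = real k * (real k - 1) / (\<epsilon> * n)"
    have D0: "D > 0"
      using D_L L by linarith
    have K_eq: "6 * real k ^ 2 * (B * D) / (\<epsilon> * \<kappa> * D) = K"
      using D0 by (simp add: K_def)
    have x: "0 \<le> x" "x \<le> 1 / 2"
    proof -
      show "0 \<le> x"
        using k \<epsilon> n by (simp add: x_def)
      have "2 * (real k * (real k - 1)) \<le> 2 * real k ^ 2"
        by (simp add: power2_eq_square algebra_simps)
      also have "\<dots> \<le> \<epsilon> * n"
        using n2 \<epsilon> by (simp add: field_simps)
      finally show "x \<le> 1 / 2"
        using \<epsilon> n by (simp add: x_def field_simps)
    qed
    have \<kappa>_le: "\<kappa> \<le> (1 - x) ^ card V"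
    proof -
      have "- 2 * x * n = - 2 * real k * (real k - 1) / \<epsilon>"
        using n \<epsilon> by (simp add: x_def field_simps)
      then show ?thesis
        using one_minus_power_ge_exp[OF x, of "card V"] by (simp add: \<kappa>_def n_def)
    qed
    have "degree_dev V F D + n * (4 * real k ^ 4 * (B * D)) \<le> b * n * D\<^sup>2"
    proof -
      have "real k * \<gamma> \<le> b / 2"
        using k by (simp add: \<gamma>_def min_def field_simps)
      then have "real k * \<gamma> * (n * D\<^sup>2) \<le> b / 2 * (n * D\<^sup>2)"
        using n by (intro mult_right_mono) auto
      then have "real k * D ^ 3 \<le> b / 2 * (n * D\<^sup>2)"
        by (simp add: D_def power2_eq_square power3_eq_cube mult_ac)
      moreover have "(B + 8 * real k ^ 4 * B) / 2 * (n * D) \<le> b / 2 * D * (n * D)"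
      proof (rule mult_right_mono)
        show "(B + 8 * real k ^ 4 * B) / 2 \<le> b / 2 * D"
          using D_parts(1) pos by (simp add: field_simps)
      qed (use n D0 in simp)
      ultimately show ?thesis
        using F(3) by (simp add: power2_eq_square algebra_simps)
    qed
    then have "exp K * (degree_dev V F D + n * (4 * real k ^ 4 * (B * D))) \<le> exp K * (b * n * D\<^sup>2)"
      by (intro mult_left_mono) auto
    also have "\<dots> = \<epsilon> * n * (\<kappa> * D)\<^sup>2 / 4"
      by (simp add: b_def power_mult_distrib)
    finally have dev: "exp K * (degree_dev V F D + n * (4 * real k ^ 4 * (B * D))) \<le> \<epsilon> * n * (\<kappa> * D)\<^sup>2 / 4" .
    have "\<exists>M. matching F M \<and> (1 - \<epsilon>) * n \<le> real (card (covered_vertices M))"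
      unfolding n_def
    proof (rule F.greedy_matching[where D = D and A = "B * D" and \<kappa> = \<kappa>])
      show "D \<le> B * D"
        using D0 by (simp add: B_def)
      show "D \<le> \<epsilon> * real (card V)"
        using n unfolding D_def n_def[symmetric] by (intro mult_right_mono) (auto simp: \<gamma>_def)
      show "1 \<le> \<kappa> * D"
        using D_parts(3) pos by (simp add: field_simps)
      show "real k * (real k - 1) / (\<epsilon> * real (card V)) \<le> 1"
        using x unfolding x_def n_def by linarith
    qed (use k \<open>V \<noteq> {}\<close> \<epsilon> F(2) pos \<kappa>_le dev in
        \<open>simp_all add: K_eq n_def x_def\<close>)
    then show "\<exists>M. matching E M \<and> (1 - \<epsilon>) * real (card V) \<le> real (card (covered_vertices M))"
      using F(1) by (auto simp: matching_def n_def)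
  qed
qed

theorem theorem1p2:
  shows "\<forall>\<epsilon>::real. \<epsilon> > 0 \<longrightarrow> (\<forall>k::nat. k \<ge> 2 \<longrightarrow>
    (\<exists>C n\<^sub>0 :: nat. C > 0 \<and> n\<^sub>0 > 0 \<and>
      (\<forall>n\<ge>n\<^sub>0. \<forall>(V :: 'a set) (E :: 'a set set).
        k_graph V E k \<and> linear_hypergraph V E \<and> card V = n \<and>
        real (min_degree V E) \<ge> real n / real k + real C \<longrightarrow>
        (\<exists>M. matching E M \<and>
          real (card (covered_vertices M)) \<ge> (1 - \<epsilon>) * real n))))"
proof (intro allI impI)
  fix \<epsilon> :: real and k :: nat
  assume \<epsilon>: "\<epsilon> > 0" and k: "k \<ge> 2"
  \<comment> \<open>Capping \<epsilon> at 1/2 brings it below 1; the coverage obtained is then at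
    least the one required.\<close>
  obtain n\<^sub>0 :: nat where n\<^sub>0: "n\<^sub>0 > 0"
    "\<And>(V :: 'a set) E. linear_k_graph V E k \<Longrightarrow> n\<^sub>0 \<le> card V \<Longrightarrow>
      (\<And>v. v \<in> V \<Longrightarrow> real (card V) / real k \<le> real (degree E v)) \<Longrightarrow>
      \<exists>M. matching E M \<and> (1 - min \<epsilon> (1 / 2)) * real (card V) \<le> real (card (covered_vertices M))"
    by (rule linear_k_graph_near_perfect_matching[of "min \<epsilon> (1 / 2)" k]) (use \<epsilon> k in auto)
  show "\<exists>C n\<^sub>0 :: nat. C > 0 \<and> n\<^sub>0 > 0 \<and>
      (\<forall>n\<ge>n\<^sub>0. \<forall>(V :: 'a set) (E :: 'a set set).
        k_graph V E k \<and> linear_hypergraph V E \<and> card V = n \<and>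
        real (min_degree V E) \<ge> real n / real k + real C \<longrightarrow>
        (\<exists>M. matching E M \<and>
          real (card (covered_vertices M)) \<ge> (1 - \<epsilon>) * real n))"
  proof (rule exI[of _ 1], rule exI[of _ n\<^sub>0], intro conjI allI impI)
    fix n and V :: "'a set" and E :: "'a set set"
    assume n: "n\<^sub>0 \<le> n"
      and H: "k_graph V E k \<and> linear_hypergraph V E \<and> card V = n \<and>
        real n / real k + real 1 \<le> real (min_degree V E)"
    interpret linear_k_graph V E k
      using H by (intro linear_k_graph.intro) auto
    have "real (card V) / real k \<le> real (degree E v)" if "v \<in> V" for v
    proof -
      have "min_degree V E \<le> degree E v"
        unfolding min_degree_def using that finite_vertices by simp
      then show ?thesis
        using H by (simp add: le_diff_eq[symmetric])
    qed
    then obtain M where M: "matching E M"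
      "(1 - min \<epsilon> (1 / 2)) * real n \<le> real (card (covered_vertices M))"
      using n\<^sub>0(2)[OF linear_k_graph_axioms] n H by blast
    have "(1 - \<epsilon>) * real n \<le> (1 - min \<epsilon> (1 / 2)) * real n"
      by (intro mult_right_mono) auto
    then show "\<exists>M. matching E M \<and> (1 - \<epsilon>) * real n \<le> real (card (covered_vertices M))"
      using M by (meson order_trans)
  qed (use n\<^sub>0 in auto)
qed

end
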